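(* For every metric graph $\Gamma$, the set $M_{\mathrm{loc}}$ has a finite number of connected components; in particular, $M_{\mathrm{loc}}$ is either finite or uncountable.
   Context: A metric graph $\Gamma$ is given by a finite connected discrete graph with vertex set $\mathcal V$ and edge set $\mathcal E$ (loops and parallel edges allowed), where each edge $e$ is assigned a length $L(e)\in(0,\infty)$ and identified with the interval $[0,L(e)]$, the endpoints $0$ and $L(e)$ corresponding to the originating vertex $o(e)$ and terminal vertex $t(e)$ of $e$; with the natural path metric $\mathrm{dist}$, $\Gamma$ is a compact metric space. The standard Laplacian $-\Delta_\Gamma$ in $L^2(\Gamma)=\bigoplus_{e}L^2(0,L(e))$ acts as $f\mapsto -f_e''$ on every edge ($f_e:=f|_e$), on the domain of functions $f$ with $f_e\in H^2(0,L(e))$ for all $e$, continuous on $\Gamma$, and satisfying the Kirchhoff condition $\sum_{t(e)=v} f_e'(L(e)) - \sum_{o(e)=v} f_e'(0)=0$ at each vertex $v$. Its eigenvalues, counted with multiplicities, are $0=\mu_1(\Gamma)<\mu_2(\Gamma)\le\mu_3(\Gamma)\le\dots$. Eigenfunctions are always taken real-valued. $M_{\mathrm{loc}}$ is the set of all $x\in\Gamma$ for which there exist an eigenfunction $\psi$ corresponding to $\mu_2(\Gamma)$ and $\varepsilon>0$ with $0\ne\psi(x)=\max_{y\in B_\varepsilon(x)}\psi(y)$, where $B_\varepsilon(x)=\{y\in\Gamma:\mathrm{dist}(x,y)<\varepsilon\}$. *)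

theory Defs
  imports
    "Graph_Theory.Digraph_Component"
    "HOL-Analysis.Analysis"
    "HOL-Library.Function_Algebras"
begin

section \<open>Sobolev functions on an interval\<close>

definition square_integrable :: "real \<Rightarrow> real \<Rightarrow> (real \<Rightarrow> real) \<Rightarrow> bool" where
  "square_integrable a b f \<longleftrightarrow>
     set_borel_measurable lborel {a<..<b} f \<and> set_integrable lborel {a<..<b} (\<lambda>x. (f x)\<^sup>2)"

definition test_function :: "real \<Rightarrow> real \<Rightarrow> (real \<Rightarrow> real) \<Rightarrow> bool" where
  "test_function a b \<phi> \<longleftrightarrow>
     \<phi> C1_differentiable_on UNIV \<and> (\<exists>c d. a < c \<and> d < b \<and> (\<forall>x. x \<notin> {c..d} \<longrightarrow> \<phi> x = 0))"

text \<open>\<open>has_L2_weak_derivative a b f g\<close>: the function \<open>f\<close> lies in \<open>H\<^sup>1(a,b)\<close> and its weak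
  derivative is (the class of) \<open>g\<close>.\<close>

definition has_L2_weak_derivative ::
    "real \<Rightarrow> real \<Rightarrow> (real \<Rightarrow> real) \<Rightarrow> (real \<Rightarrow> real) \<Rightarrow> bool" where
  "has_L2_weak_derivative a b f g \<longleftrightarrow>
     square_integrable a b f \<and> square_integrable a b g \<and>
     (\<forall>\<phi>. test_function a b \<phi> \<longrightarrow>
        (LINT x:{a<..<b}|lborel. f x * deriv \<phi> x) = - (LINT x:{a<..<b}|lborel. g x * \<phi> x))"

text \<open>\<open>f \<in> H\<^sup>2(a,b)\<close> with second weak derivative \<open>h\<close>.\<close>

definition has_L2_weak_derivative2 ::
    "real \<Rightarrow> real \<Rightarrow> (real \<Rightarrow> real) \<Rightarrow> (real \<Rightarrow> real) \<Rightarrow> bool" where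
  "has_L2_weak_derivative2 a b f h \<longleftrightarrow>
     (\<exists>g. has_L2_weak_derivative a b f g \<and> has_L2_weak_derivative a b g h)"

definition Sobolev_H2 :: "real \<Rightarrow> real \<Rightarrow> (real \<Rightarrow> real) set" where
  "Sobolev_H2 a b = {f. \<exists>h. has_L2_weak_derivative2 a b f h}"


section \<open>Metric graphs\<close>

text \<open>Loops and parallel arcs are allowed; \<open>Digraph_Component.connected\<close> is connectedness of the
  underlying undirected graph and includes that there is at least one vertex.\<close>

locale metric_graph = fin_digraph G
  for G :: "('v, 'e) pre_digraph" (structure) +
  fixes L :: "'e \<Rightarrow> real"
  assumes graph_connected: "Digraph_Component.connected G"
    and length_pos: "e \<in> arcs G \<Longrightarrow> 0 < L e"

datatype ('v, 'e) point = Vertex 'v | Inner 'e real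

context metric_graph
begin

definition points :: "('v, 'e) point set" where
  "points = Vertex ` verts G \<union> {Inner e s | e s. e \<in> arcs G \<and> 0 < s \<and> s < L e}"

text \<open>The image of the parameter \<open>s \<in> [0, L e]\<close> in the graph: endpoints are glued to vertices.\<close>

definition edge_point :: "'e \<Rightarrow> real \<Rightarrow> ('v, 'e) point" where
  "edge_point e s =
     (if s = 0 then Vertex (tail G e) else if s = L e then Vertex (head G e) else Inner e s)"

text \<open>A path is a list of segments \<open>(e, s, t)\<close>, each running along \<open>e\<close> from parameter \<open>s\<close>
  to parameter \<open>t\<close>.\<close>

fun path_between ::
    "('v, 'e) point \<Rightarrow> ('e \<times> real \<times> real) list \<Rightarrow> ('v, 'e) point \<Rightarrow> bool" where
  "path_between x [] y \<longleftrightarrow> x = y"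
| "path_between x ((e, s, t) # p) y \<longleftrightarrow>
     e \<in> arcs G \<and> s \<in> {0..L e} \<and> t \<in> {0..L e} \<and> edge_point e s = x \<and>
     path_between (edge_point e t) p y"

definition path_length :: "('e \<times> real \<times> real) list \<Rightarrow> real" where
  "path_length p = (\<Sum>(e, s, t)\<leftarrow>p. \<bar>t - s\<bar>)"

definition path_dist :: "('v, 'e) point \<Rightarrow> ('v, 'e) point \<Rightarrow> real" where
  "path_dist x y =
     (if x \<in> points \<and> y \<in> points then Inf {path_length p | p. path_between x p y} else 0)"

lemma edge_point_in_points: "e \<in> arcs G \<Longrightarrow> s \<in> {0..L e} \<Longrightarrow> edge_point e s \<in> points"
  by (auto simp: edge_point_def points_def)

lemma path_length_nonneg: "0 \<le> path_length p"
  unfolding path_length_def by (rule sum_list_nonneg) auto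

lemma path_between_append:
  "path_between x p y \<Longrightarrow> path_between y q z \<Longrightarrow> path_between x (p @ q) z"
  by (induction x p y rule: path_between.induct) auto

lemma path_length_append: "path_length (p @ q) = path_length p + path_length q"
  by (simp add: path_length_def)

lemma path_between_reverse:
  "path_between x p y \<Longrightarrow> \<exists>q. path_between y q x \<and> path_length q = path_length p"
proof (induction x p y rule: path_between.induct)
  case (1 x y)
  then show ?case by (intro exI[of _ "[]"]) auto
next
  case (2 x e s t p y)
  then obtain q where q: "path_between y q (edge_point e t)" "path_length q = path_length p"
    by auto
  have "path_between (edge_point e t) [(e, t, s)] x"
    using 2 by auto
  from path_between_append[OF q(1) this] show ?case
    using q(2) by (intro exI[of _ "q @ [(e, t, s)]"]) (auto simp: path_length_def)
qed

lemma path_between_vertices: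
  assumes "u \<in> verts G" "v \<in> verts G"
  shows "\<exists>p. path_between (Vertex u) p (Vertex v)"
proof -
  have "u \<rightarrow>\<^sup>*\<^bsub>with_proj (mk_symmetric G)\<^esub> v"
    using graph_connected assms
    by (auto simp: Digraph_Component.connected_def strongly_connected_def)
  then have "(u, v) \<in> rtrancl_on (verts G) (parcs (mk_symmetric G))"
    by (simp add: reachable_def)
  then show ?thesis
  proof (induction rule: rtrancl_on_induct)
    case base
    show ?case by (rule exI[of _ "[]"]) simp
  next
    case (step y z)
    then obtain p where p: "path_between (Vertex u) p (Vertex y)" by blast
    from step obtain e where e: "e \<in> arcs G"
      and yz: "(y = tail G e \<and> z = head G e) \<or> (y = head G e \<and> z = tail G e)"
      by (auto simp: parcs_mk_symmetric)
    have Le: "0 < L e" using e by (rule length_pos)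
    from yz have "\<exists>q. path_between (Vertex y) q (Vertex z)"
    proof
      assume "y = tail G e \<and> z = head G e"
      then show ?thesis using e Le
        by (intro exI[of _ "[(e, 0, L e)]"]) (auto simp: edge_point_def)
    next
      assume "y = head G e \<and> z = tail G e"
      then show ?thesis using e Le
        by (intro exI[of _ "[(e, L e, 0)]"]) (auto simp: edge_point_def)
    qed
    then show ?case using p path_between_append by blast
  qed
qed

lemma path_to_vertex:
  assumes "x \<in> points"
  shows "\<exists>p. \<exists>v \<in> verts G. path_between x p (Vertex v)"
  using assms unfolding points_def
proof (elim UnE)
  assume "x \<in> Vertex ` verts G"
  then show ?thesis by (metis imageE path_between.simps(1))
next
  assume "x \<in> {Inner e s | e s. e \<in> arcs G \<and> 0 < s \<and> s < L e}"
  then obtain e s where "x = Inner e s" "e \<in> arcs G" "0 < s" "s < L e" by blast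
  then show ?thesis
    by (intro exI[of _ "[(e, s, 0)]"] bexI[of _ "tail G e"]) (auto simp: edge_point_def)
qed

lemma path_exists:
  assumes "x \<in> points" "y \<in> points"
  shows "\<exists>p. path_between x p y"
proof -
  obtain p u where "u \<in> verts G" "path_between x p (Vertex u)"
    using path_to_vertex assms(1) by blast
  moreover obtain q v where "v \<in> verts G" "path_between y q (Vertex v)"
    using path_to_vertex assms(2) by blast
  moreover obtain r where "path_between (Vertex u) r (Vertex v)"
    using path_between_vertices calculation by blast
  ultimately show ?thesis
    using path_between_append path_between_reverse by meson
qed

lemma path_dist_le: "x \<in> points \<Longrightarrow> y \<in> points \<Longrightarrow> path_between x p y \<Longrightarrow> path_dist x y \<le> path_length p"
  unfolding path_dist_def
  by (auto intro!: cInf_lower bdd_belowI[of _ 0] simp: path_length_nonneg)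

lemma path_dist_approx:
  assumes "x \<in> points" "y \<in> points" "path_dist x y < r"
  shows "\<exists>p. path_between x p y \<and> path_length p < r"
proof -
  have "{path_length p | p. path_between x p y} \<noteq> {}" using path_exists assms by blast
  moreover have "bdd_below {path_length p | p. path_between x p y}"
    by (auto intro!: bdd_belowI[of _ 0] simp: path_length_nonneg)
  ultimately show ?thesis
    using cInf_less_iff[of "{path_length p | p. path_between x p y}" r] assms
    by (auto simp: path_dist_def)
qed

lemma Lipschitz_along_path:
  fixes h :: "('v, 'e) point \<Rightarrow> real"
  assumes h: "\<And>e s t. e \<in> arcs G \<Longrightarrow> s \<in> {0..L e} \<Longrightarrow> t \<in> {0..L e} \<Longrightarrow>
      \<bar>h (edge_point e s) - h (edge_point e t)\<bar> \<le> K * \<bar>t - s\<bar>"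
    and "path_between x p y"
  shows "\<bar>h x - h y\<bar> \<le> K * path_length p"
  using assms(2)
proof (induction x p y rule: path_between.induct)
  case (1 x y)
  then show ?case by (simp add: path_length_def)
next
  case (2 x e s t p y)
  then have "\<bar>h (edge_point e t) - h y\<bar> \<le> K * path_length p" by simp
  moreover have "\<bar>h x - h (edge_point e t)\<bar> \<le> K * \<bar>t - s\<bar>" using h[of e s t] 2 by auto
  ultimately show ?case by (simp add: path_length_def algebra_simps)
qed

lemma Lipschitz_path_dist:
  fixes h :: "('v, 'e) point \<Rightarrow> real"
  assumes h: "\<And>e s t. e \<in> arcs G \<Longrightarrow> s \<in> {0..L e} \<Longrightarrow> t \<in> {0..L e} \<Longrightarrow>
      \<bar>h (edge_point e s) - h (edge_point e t)\<bar> \<le> K * \<bar>t - s\<bar>"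
    and "0 < K" "x \<in> points" "y \<in> points"
  shows "\<bar>h x - h y\<bar> \<le> K * path_dist x y"
proof (rule ccontr)
  assume "\<not> ?thesis"
  then have "path_dist x y < \<bar>h x - h y\<bar> / K" using \<open>0 < K\<close> by (simp add: field_simps)
  then obtain p where "path_between x p y" "path_length p < \<bar>h x - h y\<bar> / K"
    using path_dist_approx assms by blast
  with Lipschitz_along_path[of h K, OF h] \<open>0 < K\<close> show False by (fastforce simp: field_simps)
qed

lemma path_dist_Inner_pos:
  assumes x: "x = Inner e s" "x \<in> points" and y: "y \<in> points" "x \<noteq> y"
  shows "0 < path_dist x y"
proof -
  have e: "e \<in> arcs G" "0 < s" "s < L e" using x by (auto simp: points_def)
  define r where "r = min s (L e - s)"
  define h where "h z = (case z of Vertex v \<Rightarrow> 0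
      | Inner e' t \<Rightarrow> if e' = e then max 0 (r - \<bar>t - s\<bar>) else 0)" for z :: "('v, 'e) point"
  have r: "0 < r" using e by (simp add: r_def)
  have ep: "h (edge_point e' t) = (if e' = e then max 0 (r - \<bar>t - s\<bar>) else 0)"
    if "t \<in> {0..L e'}" for e' t
    using that by (auto simp: h_def edge_point_def r_def)
  have "\<bar>h (edge_point e' t) - h (edge_point e' t')\<bar> \<le> 1 * \<bar>t' - t\<bar>"
    if "e' \<in> arcs G" "t \<in> {0..L e'}" "t' \<in> {0..L e'}" for e' t t'
    using that by (auto simp: ep)
  then have "\<bar>h x - h y\<bar> \<le> 1 * path_dist x y"
    by (rule Lipschitz_path_dist) (use x y in auto)
  moreover have "h y < h x"
    using y x r by (auto simp: h_def split: point.splits)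
  ultimately show ?thesis by linarith
qed

lemma path_dist_Vertex_pos:
  assumes u: "u \<in> verts G" and v: "v \<in> verts G" and "u \<noteq> v"
  shows "0 < path_dist (Vertex u) (Vertex v)"
proof -
  define g :: "'v \<Rightarrow> real" where "g w = (if w = u then 1 else 0)" for w
  define h where "h z = (case z of Vertex w \<Rightarrow> g w
      | Inner e t \<Rightarrow> g (tail G e) + (t / L e) * (g (head G e) - g (tail G e)))"
    for z :: "('v, 'e) point"
  define K where "K = 1 + (\<Sum>e\<in>arcs G. 1 / L e)"
  have sum0: "0 \<le> (\<Sum>e\<in>arcs G. 1 / L e)"
    using length_pos by (intro sum_nonneg) (simp add: less_imp_le)
  have K: "0 < K" using sum0 by (simp add: K_def)
  have KL: "1 / L e \<le> K" if "e \<in> arcs G" for e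
  proof -
    have "1 / L e \<le> (\<Sum>e\<in>arcs G. 1 / L e)"
      using that length_pos by (intro member_le_sum) (auto simp: less_imp_le)
    then show ?thesis by (simp add: K_def)
  qed
  have ep: "h (edge_point e t) = g (tail G e) + (t / L e) * (g (head G e) - g (tail G e))"
    if "e \<in> arcs G" for e t
    using length_pos[OF that] by (auto simp: h_def edge_point_def)
  have "\<bar>h (edge_point e s) - h (edge_point e t)\<bar> \<le> K * \<bar>t - s\<bar>" if "e \<in> arcs G" for e s t
  proof -
    have "h (edge_point e s) - h (edge_point e t)
        = (s - t) * (1 / L e) * (g (head G e) - g (tail G e))"
      using that by (simp add: ep algebra_simps diff_divide_distrib)
    then have "\<bar>h (edge_point e s) - h (edge_point e t)\<bar>
        = \<bar>t - s\<bar> * (1 / L e) * \<bar>g (head G e) - g (tail G e)\<bar>"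
      using length_pos[OF that] by (simp add: abs_mult abs_minus_commute)
    also have "\<dots> \<le> \<bar>t - s\<bar> * (1 / L e) * 1"
      using length_pos[OF that] by (intro mult_left_mono) (auto simp: g_def)
    also have "\<dots> \<le> K * \<bar>t - s\<bar>"
      using mult_left_mono[OF KL[OF that], of "\<bar>t - s\<bar>"] by (simp add: mult.commute)
    finally show ?thesis .
  qed
  then have "\<bar>h (Vertex u) - h (Vertex v)\<bar> \<le> K * path_dist (Vertex u) (Vertex v)"
    using K u v by (intro Lipschitz_path_dist) (auto simp: points_def)
  moreover have "h (Vertex u) - h (Vertex v) = 1" using \<open>u \<noteq> v\<close> by (simp add: h_def g_def)
  ultimately have "0 < K * path_dist (Vertex u) (Vertex v)" by linarith
  then show ?thesis using K by (simp add: zero_less_mult_iff)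
qed

lemma path_dist_nonneg: "0 \<le> path_dist x y"
proof (cases "x \<in> points \<and> y \<in> points")
  case True
  then have "{path_length p | p. path_between x p y} \<noteq> {}" using path_exists by blast
  then show ?thesis
    using True unfolding path_dist_def by (auto intro!: cInf_greatest simp: path_length_nonneg)
qed (auto simp: path_dist_def)

lemma path_dist_commute: "path_dist x y = path_dist y x"
proof -
  have "{path_length p | p. path_between x p y} = {path_length p | p. path_between y p x}"
    by (auto; metis path_between_reverse)
  then show ?thesis by (auto simp: path_dist_def)
qed

sublocale Gamma: Metric_space points path_dist
proof
  show "0 \<le> path_dist x y" for x y by (rule path_dist_nonneg)
  show "path_dist x y = path_dist y x" for x y by (rule path_dist_commute)
  show "path_dist x y = 0 \<longleftrightarrow> x = y" if xy: "x \<in> points" "y \<in> points" for x y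
  proof
    assume "x = y"
    then have "path_dist x y \<le> path_length []" using xy by (intro path_dist_le) auto
    then show "path_dist x y = 0"
      using path_dist_nonneg[of x y] by (simp add: path_length_def)
  next
    assume 0: "path_dist x y = 0"
    show "x = y"
    proof (rule ccontr)
      assume "x \<noteq> y"
      then have "0 < path_dist x y"
      proof (cases x)
        case (Inner e s)
        then show ?thesis using path_dist_Inner_pos xy \<open>x \<noteq> y\<close> by blast
      next
        case u: (Vertex u)
        show ?thesis
        proof (cases y)
          case (Inner e s)
          then show ?thesis
            using path_dist_Inner_pos[of y e s x] xy \<open>x \<noteq> y\<close> path_dist_commute[of x y] by auto
        next
          case (Vertex v)
          then show ?thesis
            using path_dist_Vertex_pos[of u v] u xy \<open>x \<noteq> y\<close> by (auto simp: points_def)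
        qed
      qed
      then show False using 0 by simp
    qed
  qed
  show "path_dist x z \<le> path_dist x y + path_dist y z"
    if xyz: "x \<in> points" "y \<in> points" "z \<in> points" for x y z
  proof (rule field_le_epsilon)
    fix \<epsilon> :: real assume "0 < \<epsilon>"
    obtain p where p: "path_between x p y" "path_length p < path_dist x y + \<epsilon> / 2"
      using path_dist_approx[of x y "path_dist x y + \<epsilon> / 2"] xyz \<open>0 < \<epsilon>\<close> by auto
    obtain q where q: "path_between y q z" "path_length q < path_dist y z + \<epsilon> / 2"
      using path_dist_approx[of y z "path_dist y z + \<epsilon> / 2"] xyz \<open>0 < \<epsilon>\<close> by auto
    have "path_dist x z \<le> path_length (p @ q)"
      using path_between_append[OF p(1) q(1)] xyz by (intro path_dist_le) auto
    then show "path_dist x z \<le> path_dist x y + path_dist y z + \<epsilon>"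
      using p(2) q(2) by (simp add: path_length_append)
  qed
qed


section \<open>The standard Laplacian and its eigenvalues\<close>

definition on_edge :: "(('v, 'e) point \<Rightarrow> real) \<Rightarrow> 'e \<Rightarrow> real \<Rightarrow> real" where
  "on_edge f e s = f (edge_point e s)"

text \<open>An \<open>H\<^sup>2\<close>-function that is continuous on \<open>[0, L e]\<close> is continuously differentiable up to the
  endpoints, so the one-sided derivatives below exist for all functions in the domain.\<close>

definition Kirchhoff_at :: "(('v, 'e) point \<Rightarrow> real) \<Rightarrow> 'v \<Rightarrow> bool" where
  "Kirchhoff_at f v \<longleftrightarrow>
     (\<Sum>e | e \<in> arcs G \<and> head G e = v.
        vector_derivative (on_edge f e) (at (L e) within {0..L e}))
     - (\<Sum>e | e \<in> arcs G \<and> tail G e = v.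
        vector_derivative (on_edge f e) (at 0 within {0..L e})) = 0"

text \<open>Functions on the graph are represented by total functions that vanish off \<open>points\<close>.\<close>

definition laplacian_domain :: "(('v, 'e) point \<Rightarrow> real) set" where
  "laplacian_domain =
     {f. (\<forall>x. x \<notin> points \<longrightarrow> f x = 0)
       \<and> (\<forall>e \<in> arcs G. on_edge f e \<in> Sobolev_H2 0 (L e))
       \<and> continuous_map Gamma.mtopology euclideanreal f
       \<and> (\<forall>v \<in> verts G. Kirchhoff_at f v)}"

text \<open>\<open>neg_laplacian f u\<close>: \<open>f\<close> is in the domain, and \<open>-\<Delta> f\<close> is (the class of) \<open>u\<close> in
  \<open>\<Oplus>\<^sub>e L\<^sup>2(0, L e)\<close>.\<close>

definition neg_laplacian :: "(('v, 'e) point \<Rightarrow> real) \<Rightarrow> ('e \<Rightarrow> real \<Rightarrow> real) \<Rightarrow> bool" where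
  "neg_laplacian f u \<longleftrightarrow>
     f \<in> laplacian_domain \<and>
     (\<forall>e \<in> arcs G. has_L2_weak_derivative2 0 (L e) (on_edge f e) (\<lambda>s. - u e s))"

definition eigenspace :: "real \<Rightarrow> (('v, 'e) point \<Rightarrow> real) set" where
  "eigenspace \<kappa> = {f. neg_laplacian f (\<lambda>e s. \<kappa> * on_edge f e s)}"

text \<open>Eigenfunctions are nonzero as elements of \<open>L\<^sup>2\<close>; for continuous functions this means nonzero
  at some point of some edge. (It only differs from being nonzero on \<open>points\<close> for the graph
  consisting of one vertex and no edges, where \<open>L\<^sup>2\<close> is trivial.)\<close>

definition eigenfunction :: "real \<Rightarrow> (('v, 'e) point \<Rightarrow> real) \<Rightarrow> bool" where
  "eigenfunction \<kappa> \<psi> \<longleftrightarrow>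
     \<psi> \<in> eigenspace \<kappa> \<and> (\<exists>e \<in> arcs G. \<exists>s \<in> {0..L e}. on_edge \<psi> e s \<noteq> 0)"

definition eigenvalues :: "real set" where
  "eigenvalues = {\<kappa>. \<exists>\<psi>. eigenfunction \<kappa> \<psi>}"

definition eigen_multiplicity :: "real \<Rightarrow> nat" where
  "eigen_multiplicity \<kappa> = vector_space.dim (\<lambda>(c::real) f x. c * f x) (eigenspace \<kappa>)"

text \<open>The \<open>k\<close>-th eigenvalue (\<open>k \<ge> 1\<close>) in nondecreasing order, counted with multiplicities: the
  smallest \<open>\<kappa>\<close> such that at least \<open>k\<close> eigenvalues are at most \<open>\<kappa>\<close>.\<close>

definition mu :: "nat \<Rightarrow> real" where
  "mu k = Inf {\<kappa>. k \<le> (\<Sum>\<kappa>' | \<kappa>' \<in> eigenvalues \<and> \<kappa>' \<le> \<kappa>. eigen_multiplicity \<kappa>')}"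

definition M_loc :: "('v, 'e) point set" where
  "M_loc = {x \<in> points. \<exists>\<psi> \<epsilon>. eigenfunction (mu 2) \<psi> \<and> 0 < \<epsilon> \<and>
     \<psi> x \<noteq> 0 \<and> (\<forall>y \<in> Gamma.mball x \<epsilon>. \<psi> y \<le> \<psi> x)}"

end

lemma vector_space_fun_real: "vector_space (\<lambda>(c::real) (f :: 'a \<Rightarrow> real) x. c * f x)"
  by unfold_locales (auto simp: fun_eq_iff algebra_simps)

end

theory Submission
  imports Defs
begin

text \<open>
  On each edge an eigenfunction for the eigenvalue \<open>\<kappa> = \<mu>\<^sub>2\<close>
  solves \<open>\<psi>'' = -\<kappa> \<psi>\<close>, so an interior point \<open>s\<close> of an edge belongs to \<open>M\<^sub>l\<^sub>o\<^sub>c\<close> iff some \<open>\<psi>\<close> in the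
  eigenspace has \<open>\<psi>(s) \<noteq> 0\<close> and \<open>\<psi>'(s) = 0\<close> (then \<open>\<psi>(t) = \<psi>(s) C(t - s)\<close> with \<open>C\<close> the cosine-like
  solution, and \<open>\<psi>\<close> or \<open>-\<psi>\<close> has a maximum at \<open>s\<close>). If infinitely many points of an edge have this
  property, two of them, \<open>p\<close> and \<open>q\<close>, are so close that \<open>S(p - q) \<noteq> 0\<close> for the sine-like solution
  \<open>S\<close>; then the combination \<open>S(t - q) C(x - p) - S(t - p) C(x - q)\<close>, as a function of \<open>x\<close>, is
  critical at \<open>t\<close> with value \<open>S(p - q)\<close>, for every \<open>t\<close>. Hence \<open>M\<^sub>l\<^sub>o\<^sub>c\<close> consists of finitely many
  points and finitely many whole open edges.
\<close>

section \<open>The equation \<open>f'' = -\<kappa> f\<close>\<close>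

text \<open>The solution C of C'' = -\<kappa> C with C(0) = 1 and C'(0) = 0. For \<kappa> = 0 the
  second branch gives the constant 1.\<close>

definition gen_cos :: "real \<Rightarrow> real \<Rightarrow> real" where
  "gen_cos \<kappa> x = (if \<kappa> > 0 then cos (sqrt \<kappa> * x) else cosh (sqrt (- \<kappa>) * x))"

text \<open>The solution S of S'' = -\<kappa> S with S(0) = 0 and S'(0) = 1. Here \<kappa> = 0 has
  its own branch, because dividing by \<open>sqrt 0\<close> would yield 0.\<close>

definition gen_sin :: "real \<Rightarrow> real \<Rightarrow> real" where
  "gen_sin \<kappa> x = (if \<kappa> > 0 then sin (sqrt \<kappa> * x) / sqrt \<kappa>
     else if \<kappa> = 0 then x else sinh (sqrt (- \<kappa>) * x) / sqrt (- \<kappa>))"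

lemma gen_cos_0 [simp]: "gen_cos \<kappa> 0 = 1"
  by (simp add: gen_cos_def)

lemma gen_sin_0 [simp]: "gen_sin \<kappa> 0 = 0"
  by (simp add: gen_sin_def)

lemma gen_sin_minus [simp]: "gen_sin \<kappa> (- x) = - gen_sin \<kappa> x"
  by (simp add: gen_sin_def)

lemma has_real_derivative_gen_sin:
  "(gen_sin \<kappa> has_real_derivative gen_cos \<kappa> x) (at x)"
proof -
  consider "\<kappa> > 0" | "\<kappa> = 0" | "\<kappa> < 0" by linarith
  then show ?thesis
    unfolding gen_sin_def gen_cos_def
    by cases (auto intro!: derivative_eq_intros simp: mult.assoc)
qed

lemma has_real_derivative_gen_cos:
  "(gen_cos \<kappa> has_real_derivative - \<kappa> * gen_sin \<kappa> x) (at x)"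
proof -
  \<comment> \<open>Rewrites the factor produced by the chain rule as a multiple of
    \<open>gen_sin\<close>, which carries the root in its denominator.\<close>
  have sq: "y * sqrt k = k * (y / sqrt k)" if "k > 0" for k y :: real
    using that real_div_sqrt[of k] by (metis less_imp_le times_divide_eq_left times_divide_eq_right mult.commute)
  consider "\<kappa> > 0" | "\<kappa> = 0" | "\<kappa> < 0" by linarith
  then show ?thesis
  proof cases
    case 1
    then show ?thesis
      unfolding gen_sin_def gen_cos_def using sq[of \<kappa> "sin (sqrt \<kappa> * x)"]
      by (auto intro!: derivative_eq_intros)
  next
    case 2
    then show ?thesis
      unfolding gen_sin_def gen_cos_def by (auto intro!: derivative_eq_intros)
  next
    case 3
    then show ?thesis
      unfolding gen_sin_def gen_cos_def using sq[of "- \<kappa>" "sinh (sqrt (- \<kappa>) * x)"]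
      by (auto intro!: derivative_eq_intros)
  qed
qed

lemmas gen_sin_derivative [derivative_intros] = has_real_derivative_gen_sin[THEN DERIV_chain2]
lemmas gen_cos_derivative [derivative_intros] = has_real_derivative_gen_cos[THEN DERIV_chain2]

text \<open>Conservation of energy: the derivative 2C(-\<kappa>S) + 2\<kappa>SC vanishes, and the
  value at 0 is 1.\<close>

lemma gen_cos_gen_sin_squared: "(gen_cos \<kappa> x)\<^sup>2 + \<kappa> * (gen_sin \<kappa> x)\<^sup>2 = 1"
proof -
  have "((\<lambda>x. (gen_cos \<kappa> x)\<^sup>2 + \<kappa> * (gen_sin \<kappa> x)\<^sup>2) has_real_derivative 0) (at x)" for x
    by (auto intro!: derivative_eq_intros)
  then have "(gen_cos \<kappa> x)\<^sup>2 + \<kappa> * (gen_sin \<kappa> x)\<^sup>2 = (gen_cos \<kappa> 0)\<^sup>2 + \<kappa> * (gen_sin \<kappa> 0)\<^sup>2"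
    by (intro DERIV_isconst_all) blast
  then show ?thesis by simp
qed

text \<open>The left side is, up to sign, the Wronskian of two translates of S, hence constant in t;
  it is evaluated at t = s.\<close>

lemma gen_sin_diff:
  "gen_sin \<kappa> (t - r) * gen_cos \<kappa> (t - s) - gen_sin \<kappa> (t - s) * gen_cos \<kappa> (t - r) = gen_sin \<kappa> (s - r)"
proof -
  let ?D = "\<lambda>t. gen_sin \<kappa> (t - r) * gen_cos \<kappa> (t - s) - gen_sin \<kappa> (t - s) * gen_cos \<kappa> (t - r)"
  have "(?D has_real_derivative 0) (at t)" for t
    by (auto intro!: derivative_eq_intros simp: algebra_simps)
  then have "?D t = ?D s"
    by (intro DERIV_isconst_all) blast
  then show ?thesis by simp
qed

text \<open>Since S'(0) = 1, S is positive just to the right of 0; oddness settles the left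
  side.\<close>

lemma gen_sin_isolated_zero: "\<exists>\<delta>>0. \<forall>x. x \<noteq> 0 \<and> \<bar>x\<bar> < \<delta> \<longrightarrow> gen_sin \<kappa> x \<noteq> 0"
proof -
  have d: "(gen_sin \<kappa> has_real_derivative 1) (at 0)"
    using has_real_derivative_gen_sin[of \<kappa> 0] by simp
  obtain \<delta> where \<delta>: "\<delta> > 0" "\<And>h. 0 < h \<Longrightarrow> h < \<delta> \<Longrightarrow> gen_sin \<kappa> 0 < gen_sin \<kappa> (0 + h)"
    using DERIV_pos_inc_right[OF d] by auto
  have "gen_sin \<kappa> x \<noteq> 0" if "x \<noteq> 0" "\<bar>x\<bar> < \<delta>" for x
    using \<delta>(2)[of x] \<delta>(2)[of "- x"] that by (cases "x > 0") auto
  with \<delta>(1) show ?thesis by blast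
qed

text \<open>Decides which sign of the value turns a critical point into a maximum: positive for
  \<kappa> \<ge> 0, negative for \<kappa> < 0.\<close>

lemma gen_cos_extremum:
  shows "\<kappa> \<ge> 0 \<Longrightarrow> gen_cos \<kappa> x \<le> 1" and "\<kappa> < 0 \<Longrightarrow> 1 \<le> gen_cos \<kappa> x"
  by (auto simp: gen_cos_def cosh_real_ge_1)

lemma harmonic_oscillator_unique:
  assumes I: "convex I" and s: "s \<in> I" and t: "t \<in> I"
    and f: "\<And>x. x \<in> I \<Longrightarrow> (f has_real_derivative f' x) (at x)"
    and f': "\<And>x. x \<in> I \<Longrightarrow> (f' has_real_derivative - \<kappa> * f x) (at x)"
  shows "f t = f s * gen_cos \<kappa> (t - s) + f' s * gen_sin \<kappa> (t - s)"
proof -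
  \<comment> \<open>\<open>A x\<close> and \<open>B x\<close> are the value and the derivative at s
    of the solution that has data \<open>f x\<close>, \<open>f' x\<close> at x. Both are constant,
    and the energy identity inverts this linear map to recover \<open>f t\<close>.\<close>
  define A where "A x = f x * gen_cos \<kappa> (x - s) - f' x * gen_sin \<kappa> (x - s)" for x
  define B where "B x = \<kappa> * f x * gen_sin \<kappa> (x - s) + f' x * gen_cos \<kappa> (x - s)" for x
  have "(A has_real_derivative 0) (at x)" if "x \<in> I" for x
    unfolding A_def using f[OF that] f'[OF that]
    by (auto intro!: derivative_eq_intros simp: algebra_simps)
  then have "A t = A s"
    using has_field_derivative_zero_constant[OF I] s t has_field_derivative_at_within by metis
  then have A: "A t = f s" by (simp add: A_def)
  have "(B has_real_derivative 0) (at x)" if "x \<in> I" for x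
    unfolding B_def using f[OF that] f'[OF that]
    by (auto intro!: derivative_eq_intros simp: algebra_simps)
  then have "B t = B s"
    using has_field_derivative_zero_constant[OF I] s t has_field_derivative_at_within by metis
  then have B: "B t = f' s" by (simp add: B_def)
  have "f t = f t * ((gen_cos \<kappa> (t - s))\<^sup>2 + \<kappa> * (gen_sin \<kappa> (t - s))\<^sup>2)"
    by (simp add: gen_cos_gen_sin_squared)
  also have "\<dots> = A t * gen_cos \<kappa> (t - s) + B t * gen_sin \<kappa> (t - s)"
    by (simp add: A_def B_def algebra_simps power2_eq_square)
  finally show ?thesis by (simp add: A B)
qed

section \<open>Regularity of weak solutions\<close>

lemma continuous_antiderivative:
  fixes f :: "real \<Rightarrow> real"
  assumes "continuous_on UNIV f"
  shows "\<exists>F. F p = 0 \<and> (\<forall>x. (F has_real_derivative f x) (at x))"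
proof -
  have "\<exists>F. \<forall>x :: real. -\<infinity> < ereal x \<longrightarrow> ereal x < \<infinity> \<longrightarrow> (F has_vector_derivative f x) (at x)"
    using assms by (intro einterval_antiderivative) (auto simp: continuous_on_eq_continuous_at)
  then obtain F where F: "\<And>x. (F has_real_derivative f x) (at x)"
    by (auto simp: has_real_derivative_iff_has_vector_derivative)
  have "((\<lambda>x. F x - F p) has_real_derivative f x) (at x)" for x
    using F by (auto intro!: derivative_eq_intros)
  then show ?thesis by (intro exI[of _ "\<lambda>x. F x - F p"]) auto
qed

section \<open>Construction of the test functions\<close>

text \<open>Weighted least squares: \<alpha> + \<beta>x is the orthogonal projection of u onto the
  affine functions for the weight w. The two equations are the moment conditions under which the
  weighted residual has a compactly supported second antiderivative.\<close>

lemma affine_weighted_fit: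
  fixes u w :: "real \<Rightarrow> real"
  assumes "c < d" and u: "continuous_on {c..d} u" and w: "continuous_on {c..d} w"
    and pos: "\<And>x. x \<in> {c<..<d} \<Longrightarrow> 0 < w x" and nonneg: "\<And>x. x \<in> {c..d} \<Longrightarrow> 0 \<le> w x"
  shows "\<exists>\<alpha> \<beta>. integral {c..d} (\<lambda>x. w x * (u x - (\<alpha> + \<beta> * x))) = 0 \<and>
    integral {c..d} (\<lambda>x. x * (w x * (u x - (\<alpha> + \<beta> * x)))) = 0"
proof -
  define J where "J f = integral {c..d} (\<lambda>x. w x * f x)" for f
  have int: "(\<lambda>x. w x * f x) integrable_on {c..d}" if "continuous_on {c..d} f" for f
    using that w by (intro integrable_continuous_interval continuous_intros)
  have add: "J (\<lambda>x. f x - r * g x) = J f - r * J g"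
    if "continuous_on {c..d} f" "continuous_on {c..d} g" for f g r
  proof -
    have "J (\<lambda>x. f x - r * g x) = integral {c..d} (\<lambda>x. w x * f x - r * (w x * g x))"
      unfolding J_def by (simp add: algebra_simps)
    also have "\<dots> = J f - integral {c..d} (\<lambda>x. r * (w x * g x))"
      unfolding J_def by (intro integral_diff int that integrable_on_mult_right)
    also have "\<dots> = J f - r * J g" unfolding J_def by simp
    finally show ?thesis .
  qed
  \<comment> \<open>Definiteness of the weighted inner product: a continuous nonnegative integrand
    with integral 0 vanishes, but w is positive at the interior point y.\<close>
  have pos2: "J (\<lambda>x. (f x)\<^sup>2) \<noteq> 0" if "continuous_on {c..d} f" "y \<in> {c<..<d}" "f y \<noteq> 0" for f y
  proof
    assume "J (\<lambda>x. (f x)\<^sup>2) = 0"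
    then have "\<forall>x\<in>{c..d}. w x * (f x)\<^sup>2 = 0"
      unfolding J_def using that w nonneg \<open>c < d\<close>
      by (subst (asm) integral_eq_0_iff) (auto intro!: continuous_intros)
    then have "w y * (f y)\<^sup>2 = 0" using that by auto
    with that pos[of y] show False by simp
  qed
  obtain y where y: "y \<in> {c<..<d}" using \<open>c < d\<close> dense[of c d] by auto
  have J1: "J (\<lambda>x. 1) \<noteq> 0" using pos2[of "\<lambda>x. 1" y] y by simp
  \<comment> \<open>The weighted mean, which makes x - m orthogonal to 1; the two coefficients can
    then be computed separately.\<close>
  define m where "m = J (\<lambda>x. x) / J (\<lambda>x. 1)"
  \<comment> \<open>Of two distinct interior points at least one differs from m.\<close>
  obtain z where z: "z \<in> {c<..<d}" "z - m \<noteq> 0"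
  proof -
    obtain z where "y < z" "z < d" using y dense[of y d] by auto
    with y that[of y] that[of z] show ?thesis by force
  qed
  have J2: "J (\<lambda>x. (x - m)\<^sup>2) \<noteq> 0"
    using z by (intro pos2[of "\<lambda>x. x - m" z]) (auto intro!: continuous_intros)
  have Jm: "J (\<lambda>x. x - m) = 0"
    using add[of "\<lambda>x. x" "\<lambda>x. 1" m] J1 by (simp add: m_def)
  define \<alpha> where "\<alpha> = J u / J (\<lambda>x. 1)"
  define \<beta> where "\<beta> = J (\<lambda>x. (x - m) * u x) / J (\<lambda>x. (x - m)\<^sup>2)"
  define v where "v x = (u x - \<alpha> * 1) - \<beta> * (x - m)" for x
  have cv: "continuous_on {c..d} v" unfolding v_def using u by (intro continuous_intros)
  have v0: "J v = 0"
  proof -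
    have "J v = J (\<lambda>x. u x - \<alpha> * 1) - \<beta> * J (\<lambda>x. x - m)"
      unfolding v_def using u by (intro add) (auto intro!: continuous_intros)
    also have "J (\<lambda>x. u x - \<alpha> * 1) = J u - \<alpha> * J (\<lambda>x. 1)"
      using u by (intro add) (auto intro!: continuous_intros)
    finally show ?thesis using J1 Jm by (simp add: \<alpha>_def)
  qed
  have v1: "J (\<lambda>x. (x - m) * v x) = 0"
  proof -
    have "J (\<lambda>x. (x - m) * v x) = J (\<lambda>x. ((x - m) * u x - \<alpha> * (x - m)) - \<beta> * (x - m)\<^sup>2)"
      unfolding v_def by (simp add: algebra_simps power2_eq_square)
    also have "\<dots> = J (\<lambda>x. (x - m) * u x - \<alpha> * (x - m)) - \<beta> * J (\<lambda>x. (x - m)\<^sup>2)"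
      using u by (intro add) (auto intro!: continuous_intros)
    also have "J (\<lambda>x. (x - m) * u x - \<alpha> * (x - m)) = J (\<lambda>x. (x - m) * u x) - \<alpha> * J (\<lambda>x. x - m)"
      using u by (intro add) (auto intro!: continuous_intros)
    finally show ?thesis using J2 Jm by (simp add: \<beta>_def)
  qed
  have v2: "J (\<lambda>x. x * v x) = 0"
  proof -
    have "J (\<lambda>x. x * v x) = J (\<lambda>x. (x - m) * v x - (- m) * v x)" by (simp add: algebra_simps)
    also have "\<dots> = J (\<lambda>x. (x - m) * v x) - (- m) * J v"
      using cv by (intro add) (auto intro!: continuous_intros)
    finally show ?thesis using v0 v1 by simp
  qed
  have eq: "u x - ((\<alpha> - \<beta> * m) + \<beta> * x) = v x" for x by (simp add: v_def algebra_simps)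
  show ?thesis
    using v0 v2 unfolding J_def
    by (intro exI[of _ "\<alpha> - \<beta> * m"] exI[of _ \<beta>]) (simp only: eq mult.left_commute)
qed

text \<open>Integrate twice from c. The zeroth moment makes P vanish at d, the first moment does the
  same for \<phi>; outside the interval both are constant on each half-line.\<close>

lemma compactly_supported_second_antiderivative:
  fixes \<eta> :: "real \<Rightarrow> real"
  assumes "c < d" and \<eta>: "continuous_on UNIV \<eta>" "\<And>x. x \<notin> {c<..<d} \<Longrightarrow> \<eta> x = 0"
    and i0: "integral {c..d} \<eta> = 0" and i1: "integral {c..d} (\<lambda>x. x * \<eta> x) = 0"
  obtains \<phi> P where "\<And>x. (\<phi> has_real_derivative P x) (at x)" "\<And>x. (P has_real_derivative \<eta> x) (at x)"
    "\<And>x. x \<notin> {c<..<d} \<Longrightarrow> \<phi> x = 0" "\<And>x. x \<notin> {c<..<d} \<Longrightarrow> P x = 0"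
proof -
  obtain P where P: "P c = 0" "\<And>x. (P has_real_derivative \<eta> x) (at x)"
    using continuous_antiderivative[OF \<eta>(1)] by blast
  have "continuous_on UNIV P"
    using P(2) by (meson DERIV_continuous_on has_field_derivative_at_within)
  then obtain \<phi> where \<phi>: "\<phi> c = 0" "\<And>x. (\<phi> has_real_derivative P x) (at x)"
    using continuous_antiderivative by blast
  have FTC: "integral {c..d} f = F d - F c" if "\<And>x. (F has_real_derivative f x) (at x)" for F f
    using that \<open>c < d\<close>
    by (intro integral_unique fundamental_theorem_of_calculus)
       (auto simp: has_real_derivative_iff_has_vector_derivative intro: has_vector_derivative_at_within)
  have const: "F x = 0" if F: "\<And>x. (F has_real_derivative f x) (at x)" and "F c = 0" "F d = 0"
    and f: "\<And>x. x \<notin> {c<..<d} \<Longrightarrow> f x = 0" and x: "x \<notin> {c<..<d}" for F f x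
  proof -
    have zero: "F y = 0" if "convex S" "S \<inter> {c<..<d} = {}" "x \<in> S" "y \<in> S" "F x = 0" for S x y
    proof -
      have "(F has_real_derivative 0) (at z within S)" if "z \<in> S" for z
      proof -
        have "f z = 0" using f that \<open>S \<inter> {c<..<d} = {}\<close> by blast
        then show ?thesis using F[of z] by (metis has_field_derivative_at_within)
      qed
      with has_field_derivative_zero_constant[OF \<open>convex S\<close>] show ?thesis
        using that by metis
    qed
    show ?thesis
    proof (cases "x \<le> c")
      case True
      have "{..c} \<inter> {c<..<d} = {}" by auto
      then show ?thesis using zero[of "{..c}" c x] \<open>F c = 0\<close> True by simp
    next
      case False
      have "{d..} \<inter> {c<..<d} = {}" by auto
      then show ?thesis using zero[of "{d..}" d x] \<open>F d = 0\<close> x False by simp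
    qed
  qed
  have Pd: "P d = 0" using FTC[OF P(2)] i0 P(1) by simp
  \<comment> \<open>Integration by parts: the first moment of \<eta> equals d P(d) - \<phi>(d), and
    P(d) is already known to be 0.\<close>
  have "((\<lambda>x. x * P x - \<phi> x) has_real_derivative x * \<eta> x) (at x)" for x
    using P(2)[of x] \<phi>(2)[of x] by (auto intro!: derivative_eq_intros)
  from FTC[OF this] have \<phi>d: "\<phi> d = 0" using i1 P(1) \<phi>(1) Pd by simp
  have P0: "P x = 0" if "x \<notin> {c<..<d}" for x
    using const[of P \<eta> x] P Pd \<eta>(2) that by auto
  have "\<phi> x = 0" if "x \<notin> {c<..<d}" for x
    using const[of \<phi> P x] \<phi> \<phi>d P0 that by auto
  with that \<phi>(2) P(2) P0 show ?thesis by blast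
qed


section \<open>Weak solutions are classical\<close>

text \<open>Transfers the weak formulation to the gauge integral, where the fundamental theorem of
  calculus applies.\<close>

lemma set_lebesgue_integral_open_interval_continuous:
  fixes f :: "real \<Rightarrow> real"
  assumes "continuous_on {a..b} f"
  shows "(LINT x:{a<..<b}|lborel. f x) = integral {a..b} f"
proof -
  have "set_integrable lborel {a<..<b} f"
    using borel_integrable_atLeastAtMost'[OF assms] by (rule set_integrable_subset) auto
  then show ?thesis
    by (simp add: set_borel_integral_eq_integral integral_open_interval_real)
qed

lemma test_functionI:
  assumes "\<And>x. (\<phi> has_real_derivative P x) (at x)" "continuous_on UNIV P"
    "a < c" "d < b" "\<And>x. x \<notin> {c<..<d} \<Longrightarrow> \<phi> x = 0"
  shows "test_function a b \<phi>"
  unfolding test_function_def C1_differentiable_on_def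
  using assms
  by (intro conjI exI[of _ P] exI[of _ c] exI[of _ d])
     (auto simp: has_real_derivative_iff_has_vector_derivative)

text \<open>With \<open>H'' = -\<kappa> f\<close>, the function \<open>u = f - H\<close> is orthogonal to all second derivatives of test
  functions. Testing with \<open>\<phi>'' = w (u - q)\<close>, where \<open>q\<close> is the best affine approximation of \<open>u\<close>
  for the weight \<open>w\<close>, gives \<open>\<integral> w (u - q)\<^sup>2 = 0\<close>.\<close>

lemma weak_solution_locally_classical:
  assumes f: "continuous_on {0..l} f"
    and weak: "has_L2_weak_derivative2 0 l f (\<lambda>s. - (\<kappa> * f s))"
    and cd: "0 < c" "c < d" "d < l"
    and H: "\<And>x. (H has_real_derivative H1 x) (at x)"
    and H1: "\<And>x. (H1 has_real_derivative - \<kappa> * fe x) (at x)"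
    and fe: "continuous_on UNIV fe" "\<And>x. x \<in> {0..l} \<Longrightarrow> fe x = f x"
  shows "\<exists>\<alpha> \<beta>. \<forall>x\<in>{c<..<d}. f x = H x + (\<alpha> + \<beta> * x)"
proof -
  obtain g where fg: "has_L2_weak_derivative 0 l f g"
    and gh: "has_L2_weak_derivative 0 l g (\<lambda>s. - (\<kappa> * f s))"
    using weak by (auto simp: has_L2_weak_derivative2_def)
  have cH: "continuous_on S H" for S
    using H by (meson DERIV_continuous_on has_field_derivative_at_within)
  define U where "U x = fe x - H x" for x
  have cU: "continuous_on S U" for S
    unfolding U_def using fe(1) cH by (intro continuous_intros) (auto intro: continuous_on_subset)
  \<comment> \<open>The cut-off at 0 gives a continuous weight on the whole line that is positive
    exactly on the open interval, so that \<eta> is continuous and supported in [c, d].\<close>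
  define w where "w x = max 0 ((x - c) * (d - x))" for x
  have cw: "continuous_on S w" for S
    unfolding w_def by (intro continuous_intros)
  have w_pos: "0 < w x" if "x \<in> {c<..<d}" for x
    using that by (simp add: w_def)
  have w_nonneg: "0 \<le> w x" for x by (simp add: w_def)
  have w_out: "w x = 0" if "x \<notin> {c<..<d}" for x
    using that cd by (auto simp: w_def max_def zero_le_mult_iff)
  obtain \<alpha> \<beta> where fit: "integral {c..d} (\<lambda>x. w x * (U x - (\<alpha> + \<beta> * x))) = 0"
      "integral {c..d} (\<lambda>x. x * (w x * (U x - (\<alpha> + \<beta> * x)))) = 0"
    using affine_weighted_fit[OF cd(2) cU cw w_pos w_nonneg] by blast
  define \<eta> where "\<eta> x = w x * (U x - (\<alpha> + \<beta> * x))" for x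
  have c\<eta>: "continuous_on S \<eta>" for S
    unfolding \<eta>_def by (intro continuous_intros cw cU)
  have \<eta>_out: "\<eta> x = 0" if "x \<notin> {c<..<d}" for x
    using w_out[OF that] by (simp add: \<eta>_def)
  have fit': "integral {c..d} \<eta> = 0" "integral {c..d} (\<lambda>x. x * \<eta> x) = 0"
    using fit unfolding \<eta>_def[abs_def] by simp_all
  obtain \<phi> P where \<phi>: "\<And>x. (\<phi> has_real_derivative P x) (at x)"
    and P: "\<And>x. (P has_real_derivative \<eta> x) (at x)"
    and \<phi>_out: "\<And>x. x \<notin> {c<..<d} \<Longrightarrow> \<phi> x = 0" and P_out: "\<And>x. x \<notin> {c<..<d} \<Longrightarrow> P x = 0"
    using compactly_supported_second_antiderivative[OF cd(2) c\<eta> \<eta>_out fit'] by blast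
  have c\<phi>: "continuous_on S \<phi>" and cP: "continuous_on S P" for S
    using \<phi> P by (meson DERIV_continuous_on has_field_derivative_at_within)+
  have dP: "deriv P = \<eta>" and d\<phi>: "deriv \<phi> = P"
    using P \<phi> by (auto intro!: DERIV_imp_deriv)
  \<comment> \<open>Both weak derivatives are used in turn: P is the test function for f, then
    \<phi> the one for g.\<close>
  have "(LINT x:{0<..<l}|lborel. f x * \<eta> x) = - (LINT x:{0<..<l}|lborel. g x * P x)"
    using fg test_functionI[OF P c\<eta> cd(1) cd(3) P_out]
    unfolding has_L2_weak_derivative_def dP[symmetric] by blast
  also have "(LINT x:{0<..<l}|lborel. g x * P x)
      = - (LINT x:{0<..<l}|lborel. - (\<kappa> * f x) * \<phi> x)"
    using gh test_functionI[OF \<phi> cP cd(1) cd(3) \<phi>_out]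
    unfolding has_L2_weak_derivative_def d\<phi>[symmetric] by blast
  finally have W: "integral {0..l} (\<lambda>x. f x * \<eta> x) = integral {0..l} (\<lambda>x. - (\<kappa> * f x) * \<phi> x)"
    using f c\<eta> c\<phi>
    by (subst (asm) (1 2) set_lebesgue_integral_open_interval_continuous)
       (auto intro!: continuous_intros)
  \<comment> \<open>Green's identity for H and \<phi>; the boundary terms vanish because P and
    \<phi> are 0 at both ends. Subtracting it from the weak equation cancels the terms with \<kappa>
    and leaves the integral of U\<eta>.\<close>
  have "((\<lambda>x. H x * \<eta> x + \<kappa> * fe x * \<phi> x) has_integral
      (H l * P l - H1 l * \<phi> l) - (H 0 * P 0 - H1 0 * \<phi> 0)) {0..l}"
  proof (rule fundamental_theorem_of_calculus)
    show "0 \<le> l" using cd by simp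
    have "((\<lambda>x. H x * P x - H1 x * \<phi> x) has_real_derivative H x * \<eta> x + \<kappa> * fe x * \<phi> x) (at x)" for x
      using H[of x] H1[of x] P[of x] \<phi>[of x]
      by (auto intro!: derivative_eq_intros simp: algebra_simps)
    then show "((\<lambda>x. H x * P x - H1 x * \<phi> x) has_vector_derivative
        H x * \<eta> x + \<kappa> * fe x * \<phi> x) (at x within {0..l})" for x
      by (auto simp: has_real_derivative_iff_has_vector_derivative
          intro: has_vector_derivative_at_within)
  qed
  then have parts: "((\<lambda>x. H x * \<eta> x + \<kappa> * fe x * \<phi> x) has_integral 0) {0..l}"
    using cd P_out \<phi>_out by simp
  have "((\<lambda>x. f x * \<eta> x - - (\<kappa> * f x) * \<phi> x) has_integral
      integral {0..l} (\<lambda>x. f x * \<eta> x) - integral {0..l} (\<lambda>x. - (\<kappa> * f x) * \<phi> x)) {0..l}"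
    using f c\<eta> c\<phi>
    by (intro has_integral_diff integrable_integral integrable_continuous_interval continuous_intros)
  from has_integral_diff[OF this parts]
  have D: "((\<lambda>x. f x * \<eta> x - - (\<kappa> * f x) * \<phi> x - (H x * \<eta> x + \<kappa> * fe x * \<phi> x))
      has_integral 0) {0..l}"
    unfolding W by simp
  have "((\<lambda>x. U x * \<eta> x) has_integral 0) {0..l}"
    by (rule has_integral_eq[OF _ D]) (simp add: U_def fe(2) algebra_simps)
  moreover have "((\<lambda>x. U x * \<eta> x) has_integral integral {c..d} (\<lambda>x. U x * \<eta> x)) {0..l}"
    using cd \<eta>_out
    by (intro has_integral_on_superset[OF integrable_integral]
        integrable_continuous_interval continuous_intros cU c\<eta>) auto
  ultimately have "integral {c..d} (\<lambda>x. U x * \<eta> x) = 0"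
    using has_integral_unique by blast
  moreover have "continuous_on {c..d} (\<lambda>x. U x * \<eta> x)"
    by (intro continuous_intros cU c\<eta>)
  ultimately have D1: "((\<lambda>x. U x * \<eta> x) has_integral 0) {c..d}"
    using integrable_integral[OF integrable_continuous_interval] by metis
  \<comment> \<open>The moments of \<eta> vanish, so the affine fit may be subtracted from U, which
    turns U\<eta> into the weighted square of the residual.\<close>
  have D2: "((\<lambda>x. \<alpha> * \<eta> x + \<beta> * (x * \<eta> x)) has_integral \<alpha> * 0 + \<beta> * 0) {c..d}"
  proof (intro has_integral_add has_integral_mult_right)
    show "(\<eta> has_integral 0) {c..d}"
      using integrable_integral[OF integrable_continuous_interval[OF c\<eta>]] fit'(1) by metis
    have "continuous_on {c..d} (\<lambda>x. x * \<eta> x)" by (intro continuous_intros c\<eta>)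
    then show "((\<lambda>x. x * \<eta> x) has_integral 0) {c..d}"
      using integrable_integral[OF integrable_continuous_interval] fit'(2) by metis
  qed
  have "((\<lambda>x. U x * \<eta> x - (\<alpha> * \<eta> x + \<beta> * (x * \<eta> x))) has_integral 0) {c..d}"
    using has_integral_diff[OF D1 D2] by simp
  then have "integral {c..d} (\<lambda>x. w x * (U x - (\<alpha> + \<beta> * x))\<^sup>2) = 0"
    by (intro integral_unique) (simp add: \<eta>_def power2_eq_square algebra_simps)
  then have zero: "\<forall>x\<in>{c..d}. w x * (U x - (\<alpha> + \<beta> * x))\<^sup>2 = 0"
    using cd w_nonneg by (subst (asm) integral_eq_0_iff) (auto intro!: continuous_intros cw cU)
  have "U x = \<alpha> + \<beta> * x" if "x \<in> {c<..<d}" for x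
  proof -
    have "w x * (U x - (\<alpha> + \<beta> * x))\<^sup>2 = 0"
      using that zero by simp
    then show ?thesis using w_pos[OF that] by simp
  qed
  then have "f x = H x + (\<alpha> + \<beta> * x)" if "x \<in> {c<..<d}" for x
    using that cd fe(2)[of x] by (simp add: U_def algebra_simps)
  then show ?thesis by blast
qed

text \<open>Locally f is a second antiderivative of -\<kappa>f plus an affine function, hence twice
  differentiable. Uniqueness identifies it on the open interval with an explicit solution F, and
  continuity extends this to the endpoints.\<close>

lemma weak_solution_classical:
  assumes l: "0 < l" and f: "continuous_on {0..l} f"
    and weak: "has_L2_weak_derivative2 0 l f (\<lambda>s. - (\<kappa> * f s))"
  shows "\<exists>F F'. (\<forall>x. (F has_real_derivative F' x) (at x)) \<and>
    (\<forall>x. (F' has_real_derivative - \<kappa> * F x) (at x)) \<and> (\<forall>x\<in>{0..l}. f x = F x)"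
proof -
  \<comment> \<open>Constant extension beyond the interval, so that antiderivatives exist on the
    whole line.\<close>
  define fe where "fe x = f (max 0 (min l x))" for x
  have fe: "fe x = f x" if "x \<in> {0..l}" for x using that by (simp add: fe_def)
  have cfe: "continuous_on UNIV fe"
    unfolding fe_def using l
    by (intro continuous_on_compose2[OF f] continuous_intros) auto
  obtain H1 where H1: "\<And>x. (H1 has_real_derivative - \<kappa> * fe x) (at x)"
    using continuous_antiderivative[of "\<lambda>x. - \<kappa> * fe x"] continuous_on_mult_left[OF cfe] by blast
  have "continuous_on UNIV H1"
    using H1 by (meson DERIV_continuous_on has_field_derivative_at_within)
  then obtain H where H: "\<And>x. (H has_real_derivative H1 x) (at x)"
    using continuous_antiderivative by blast
  \<comment> \<open>\<alpha> and \<beta> depend on the subinterval chosen around x;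
    \<open>deriv f\<close> gives a derivative independent of this choice.\<close>
  have deriv: "(f has_real_derivative deriv f x) (at x) \<and>
      (deriv f has_real_derivative - \<kappa> * f x) (at x)" if x: "x \<in> {0<..<l}" for x
  proof -
    obtain c d where cd: "0 < c" "c < x" "x < d" "d < l"
      using x dense[of 0 x] dense[of x l] by auto
    obtain \<alpha> \<beta> where eq: "\<And>y. y \<in> {c<..<d} \<Longrightarrow> f y = H y + (\<alpha> + \<beta> * y)"
      using weak_solution_locally_classical[OF f weak cd(1) _ cd(4) H H1 cfe fe] cd by fastforce
    have 1: "(f has_real_derivative H1 y + \<beta>) (at y)" if y: "y \<in> {c<..<d}" for y
    proof (rule has_field_derivative_transform_within_open[OF _ _ y])
      show "((\<lambda>y. H y + (\<alpha> + \<beta> * y)) has_real_derivative H1 y + \<beta>) (at y)"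
        using H[of y] by (auto intro!: derivative_eq_intros)
    qed (auto simp: eq)
    have xcd: "x \<in> {c<..<d}" using cd by simp
    have "(deriv f has_real_derivative - \<kappa> * f x) (at x)"
    proof (rule has_field_derivative_transform_within_open[OF _ _ xcd])
      show "((\<lambda>y. H1 y + \<beta>) has_real_derivative - \<kappa> * f x) (at x)"
        using H1[of x] fe[of x] x by (auto intro!: derivative_eq_intros)
      show "\<And>y. y \<in> {c<..<d} \<Longrightarrow> H1 y + \<beta> = deriv f y"
        using 1 by (metis DERIV_imp_deriv)
    qed auto
    then show ?thesis using 1[OF xcd] DERIV_imp_deriv by metis
  qed
  define s where "s = l / 2"
  define F where "F t = f s * gen_cos \<kappa> (t - s) + deriv f s * gen_sin \<kappa> (t - s)" for t
  define F' where "F' t = - \<kappa> * f s * gen_sin \<kappa> (t - s) + deriv f s * gen_cos \<kappa> (t - s)" for t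
  have F: "(F has_real_derivative F' x) (at x)" for x
    unfolding F_def F'_def by (auto intro!: derivative_eq_intros)
  have F': "(F' has_real_derivative - \<kappa> * F x) (at x)" for x
    unfolding F_def F'_def by (auto intro!: derivative_eq_intros simp: algebra_simps)
  have eq: "f t - F t = 0" if "t \<in> {0<..<l}" for t
    using harmonic_oscillator_unique[of "{0<..<l}" s t f "deriv f" \<kappa>] deriv that l
    by (simp add: F_def s_def)
  have "f t - F t = 0" if "t \<in> {0..l}" for t
  proof (rule continuous_constant_on_closure[of "{0<..<l}" "\<lambda>t. f t - F t"])
    have "continuous_on {0..l} F"
      using F by (meson DERIV_continuous_on has_field_derivative_at_within)
    then show "continuous_on (closure {0<..<l}) (\<lambda>t. f t - F t)"
      using l f by (simp add: continuous_on_diff)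
  qed (use eq that l in auto)
  with F F' show ?thesis by (intro exI[of _ F] exI[of _ F']) auto
qed

section \<open>Linearity of the eigenvalue problem\<close>

text \<open>Dominated by f^2 + g^2, because 2|uv| \<le> u^2 + v^2.\<close>

lemma square_integrable_mult:
  assumes "square_integrable a b f" "square_integrable a b g"
  shows "set_integrable lborel {a<..<b} (\<lambda>x. f x * g x)"
  unfolding set_integrable_def
proof (rule Bochner_Integration.integrable_bound)
  show "integrable lborel (\<lambda>x. indicator {a<..<b} x *\<^sub>R ((f x)\<^sup>2 + (g x)\<^sup>2))"
    using assms set_integral_add(1)[of lborel "{a<..<b}" "\<lambda>x. (f x)\<^sup>2" "\<lambda>x. (g x)\<^sup>2"]
    by (simp add: square_integrable_def set_integrable_def)
  have "(\<lambda>x. (indicator {a<..<b} x *\<^sub>R f x) * (indicator {a<..<b} x *\<^sub>R g x))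
      \<in> borel_measurable lborel"
    using assms unfolding square_integrable_def set_borel_measurable_def
    by (intro borel_measurable_times) auto
  also have "(\<lambda>x. (indicator {a<..<b} x *\<^sub>R f x) * (indicator {a<..<b} x *\<^sub>R g x))
      = (\<lambda>x. indicator {a<..<b} x *\<^sub>R (f x * g x))"
    by (auto simp: indicator_def)
  finally show "(\<lambda>x. indicator {a<..<b} x *\<^sub>R (f x * g x)) \<in> borel_measurable lborel" .
  have "\<bar>u * v\<bar> \<le> u\<^sup>2 + v\<^sup>2" for u v :: real
    using sum_squares_bound[of "\<bar>u\<bar>" "\<bar>v\<bar>"] mult_nonneg_nonneg[OF abs_ge_zero[of u] abs_ge_zero[of v]]
    unfolding abs_mult power2_abs by linarith
  then show "AE x in lborel. norm (indicator {a<..<b} x *\<^sub>R (f x * g x))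
      \<le> norm (indicator {a<..<b} x *\<^sub>R ((f x)\<^sup>2 + (g x)\<^sup>2))"
    by (intro AE_I2) (auto simp: indicator_def)
qed

lemma square_integrable_lincomb:
  assumes f: "square_integrable a b f" and g: "square_integrable a b g"
  shows "square_integrable a b (\<lambda>x. r * f x + q * g x)"
  unfolding square_integrable_def
proof
  have "(\<lambda>x. r * (indicator {a<..<b} x *\<^sub>R f x) + q * (indicator {a<..<b} x *\<^sub>R g x))
      \<in> borel_measurable lborel"
    using f g unfolding square_integrable_def set_borel_measurable_def
    by (intro borel_measurable_add borel_measurable_times borel_measurable_const) auto
  also have "(\<lambda>x. r * (indicator {a<..<b} x *\<^sub>R f x) + q * (indicator {a<..<b} x *\<^sub>R g x))
      = (\<lambda>x. indicator {a<..<b} x *\<^sub>R (r * f x + q * g x))"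
    by (auto simp: indicator_def)
  finally show "set_borel_measurable lborel {a<..<b} (\<lambda>x. r * f x + q * g x)"
    by (simp add: set_borel_measurable_def)
  have "set_integrable lborel {a<..<b}
      (\<lambda>x. r\<^sup>2 * (f x * f x) + 2 * r * q * (f x * g x) + q\<^sup>2 * (g x * g x))"
    using f g by (intro set_integral_add set_integrable_mult_right square_integrable_mult)
  then show "set_integrable lborel {a<..<b} (\<lambda>x. (r * f x + q * g x)\<^sup>2)"
    by (simp add: power2_eq_square algebra_simps)
qed

lemma square_integrable_continuous:
  assumes "continuous_on {a..b} f"
  shows "square_integrable a b f"
  unfolding square_integrable_def
proof
  show "set_borel_measurable lborel {a<..<b} f"
    using set_integrable_subset[OF borel_integrable_atLeastAtMost'[OF assms], of "{a<..<b}"]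
    by (force simp: set_integrable_def set_borel_measurable_def)
  have "set_integrable lborel {a..b} (\<lambda>x. (f x)\<^sup>2)"
    using assms by (intro borel_integrable_atLeastAtMost' continuous_intros)
  then show "set_integrable lborel {a<..<b} (\<lambda>x. (f x)\<^sup>2)"
    by (rule set_integrable_subset) auto
qed

lemma test_function_square_integrable:
  assumes "test_function a b \<phi>"
  shows "square_integrable a b \<phi>" "square_integrable a b (deriv \<phi>)"
proof -
  obtain D where D: "\<And>x. (\<phi> has_real_derivative D x) (at x)" "continuous_on UNIV D"
    using assms unfolding test_function_def C1_differentiable_on_def
    by (auto simp: has_real_derivative_iff_has_vector_derivative)
  have "deriv \<phi> = D" using D(1) by (auto intro: DERIV_imp_deriv)
  moreover have "continuous_on {a..b} D" using D(2) continuous_on_subset by blast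
  moreover have "continuous_on {a..b} \<phi>"
    using D(1) by (meson DERIV_continuous_on has_field_derivative_at_within)
  ultimately show "square_integrable a b \<phi>" "square_integrable a b (deriv \<phi>)"
    by (auto intro: square_integrable_continuous)
qed

lemma has_L2_weak_derivative_lincomb:
  assumes f: "has_L2_weak_derivative a b f f'" and g: "has_L2_weak_derivative a b g g'"
  shows "has_L2_weak_derivative a b (\<lambda>x. r * f x + q * g x) (\<lambda>x. r * f' x + q * g' x)"
proof -
  have sq: "square_integrable a b f" "square_integrable a b f'"
      "square_integrable a b g" "square_integrable a b g'"
    using f g by (auto simp: has_L2_weak_derivative_def)
  have lin: "(LINT x:{a<..<b}|lborel. (r * u x + q * v x) * \<phi> x)
      = r * (LINT x:{a<..<b}|lborel. u x * \<phi> x) + q * (LINT x:{a<..<b}|lborel. v x * \<phi> x)"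
    if "square_integrable a b u" "square_integrable a b v" "square_integrable a b \<phi>" for u v \<phi>
  proof -
    have "(LINT x:{a<..<b}|lborel. (r * u x + q * v x) * \<phi> x)
        = (LINT x:{a<..<b}|lborel. r * (u x * \<phi> x) + q * (v x * \<phi> x))"
      by (simp add: algebra_simps)
    also have "\<dots> = (LINT x:{a<..<b}|lborel. r * (u x * \<phi> x)) + (LINT x:{a<..<b}|lborel. q * (v x * \<phi> x))"
      using that by (intro set_integral_add set_integrable_mult_right square_integrable_mult)
    finally show ?thesis by simp
  qed
  show ?thesis
    unfolding has_L2_weak_derivative_def
  proof (intro conjI allI impI square_integrable_lincomb sq)
    fix \<phi> assume \<phi>: "test_function a b \<phi>"
    then show "(LINT x:{a<..<b}|lborel. (r * f x + q * g x) * deriv \<phi> x)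
        = - (LINT x:{a<..<b}|lborel. (r * f' x + q * g' x) * \<phi> x)"
      using f g test_function_square_integrable[OF \<phi>] sq
      by (simp add: lin has_L2_weak_derivative_def)
  qed
qed

lemma has_L2_weak_derivative2_lincomb:
  assumes "has_L2_weak_derivative2 a b f f'" "has_L2_weak_derivative2 a b g g'"
  shows "has_L2_weak_derivative2 a b (\<lambda>x. r * f x + q * g x) (\<lambda>x. r * f' x + q * g' x)"
  using assms has_L2_weak_derivative_lincomb unfolding has_L2_weak_derivative2_def by metis

section \<open>Eigenfunctions restricted to an edge\<close>

context metric_graph
begin

text \<open>The segment itself is a path. Equality can fail, since a route through the rest of the
  graph may be shorter.\<close>

lemma path_dist_edge_point_le:
  assumes "e \<in> arcs G" "s \<in> {0..L e}" "t \<in> {0..L e}"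
  shows "path_dist (edge_point e s) (edge_point e t) \<le> \<bar>t - s\<bar>"
  using path_dist_le[of "edge_point e s" "edge_point e t" "[(e, s, t)]"] assms
  by (simp add: edge_point_in_points path_length_def)

lemma continuous_map_edge_point:
  assumes e: "e \<in> arcs G"
  shows "continuous_map (top_of_set {0..L e}) Gamma.mtopology (edge_point e)"
  unfolding Gamma.continuous_map_to_metric
proof (intro ballI allI impI)
  fix s \<epsilon> :: real assume s: "s \<in> topspace (top_of_set {0..L e})" and "0 < \<epsilon>"
  have "edge_point e t \<in> Gamma.mball (edge_point e s) \<epsilon>" if "t \<in> {0..L e} \<inter> ball s \<epsilon>" for t
    using path_dist_edge_point_le[OF e, of s t] edge_point_in_points[OF e] s that
    by (auto simp: dist_real_def abs_minus_commute)
  then show "\<exists>U. openin (top_of_set {0..L e}) U \<and> s \<in> U \<and>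
      (\<forall>t\<in>U. edge_point e t \<in> Gamma.mball (edge_point e s) \<epsilon>)"
    using s \<open>0 < \<epsilon>\<close> by (intro exI[of _ "{0..L e} \<inter> ball s \<epsilon>"]) (auto simp: openin_open)
qed

lemma continuous_on_edge:
  assumes "continuous_map Gamma.mtopology euclideanreal f" "e \<in> arcs G"
  shows "continuous_on {0..L e} (on_edge f e)"
  using continuous_map_compose[OF continuous_map_edge_point[OF assms(2)] assms(1)]
  by (simp add: on_edge_def[abs_def] o_def)

lemma eigenspace_on_edge:
  assumes "f \<in> eigenspace \<kappa>" "e \<in> arcs G"
  obtains F F' where "\<And>x. (F has_real_derivative F' x) (at x)"
    "\<And>x. (F' has_real_derivative - \<kappa> * F x) (at x)" "\<And>x. x \<in> {0..L e} \<Longrightarrow> on_edge f e x = F x"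
proof -
  have "continuous_on {0..L e} (on_edge f e)"
    using assms by (auto simp: eigenspace_def neg_laplacian_def laplacian_domain_def intro: continuous_on_edge)
  moreover have "has_L2_weak_derivative2 0 (L e) (on_edge f e) (\<lambda>s. - (\<kappa> * on_edge f e s))"
    using assms by (auto simp: eigenspace_def neg_laplacian_def)
  ultimately show ?thesis
    using weak_solution_classical[OF length_pos[OF assms(2)]] that by metis
qed

text \<open>Guarantees that the terms of the Kirchhoff condition are genuine (at the endpoints
  one-sided) derivatives, hence linear in f.\<close>

lemma on_edge_differentiable:
  assumes "f \<in> eigenspace \<kappa>" "e \<in> arcs G" "x \<in> {0..L e}"
  shows "(on_edge f e has_vector_derivative
    vector_derivative (on_edge f e) (at x within {0..L e})) (at x within {0..L e})"
proof -
  obtain F F' where F: "\<And>x. (F has_real_derivative F' x) (at x)"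
    and eq: "\<And>x. x \<in> {0..L e} \<Longrightarrow> on_edge f e x = F x"
    using eigenspace_on_edge[OF assms(1,2)] by metis
  have "(F has_vector_derivative F' x) (at x within {0..L e})"
    using F[of x] by (simp add: has_real_derivative_iff_has_vector_derivative has_vector_derivative_at_within)
  then have "(on_edge f e has_vector_derivative F' x) (at x within {0..L e})"
    by (rule has_vector_derivative_transform[rotated 2]) (use assms eq in auto)
  then show ?thesis
    using vector_derivative_within_closed_interval length_pos[OF assms(2)] assms(3) by metis
qed

lemma eigenspace_lincomb:
  assumes f: "f \<in> eigenspace \<kappa>" and g: "g \<in> eigenspace \<kappa>"
  shows "(\<lambda>x. r * f x + q * g x) \<in> eigenspace \<kappa>" (is "?h \<in> _")
proof -
  have on_edge: "on_edge ?h e = (\<lambda>s. r * on_edge f e s + q * on_edge g e s)" for e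
    by (simp add: on_edge_def fun_eq_iff)
  have weak: "has_L2_weak_derivative2 0 (L e) (on_edge ?h e) (\<lambda>s. - (\<kappa> * on_edge ?h e s))"
    if "e \<in> arcs G" for e
  proof -
    have "has_L2_weak_derivative2 0 (L e) (on_edge ?h e)
        (\<lambda>s. r * - (\<kappa> * on_edge f e s) + q * - (\<kappa> * on_edge g e s))"
      unfolding on_edge using f g that
      by (intro has_L2_weak_derivative2_lincomb) (auto simp: eigenspace_def neg_laplacian_def)
    moreover have "r * - (\<kappa> * on_edge f e s) + q * - (\<kappa> * on_edge g e s) = - (\<kappa> * on_edge ?h e s)" for s
      unfolding on_edge by (simp add: algebra_simps)
    ultimately show ?thesis by simp
  qed
  have vd: "vector_derivative (on_edge ?h e) (at x within {0..L e})
      = r * vector_derivative (on_edge f e) (at x within {0..L e})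
      + q * vector_derivative (on_edge g e) (at x within {0..L e})"
    if "e \<in> arcs G" "x \<in> {0..L e}" for e x
    unfolding on_edge
    using on_edge_differentiable[OF f that] on_edge_differentiable[OF g that] length_pos[OF that(1)] that(2)
    by (intro vector_derivative_within_closed_interval)
       (auto intro!: derivative_eq_intros has_vector_derivative_add has_vector_derivative_mult_right)
  have "Kirchhoff_at ?h v" if v: "v \<in> verts G" for v
  proof -
    let ?D = "\<lambda>f e x. vector_derivative (on_edge f e) (at x within {0..L e})"
    let ?I = "{e. e \<in> arcs G \<and> head G e = v}" and ?O = "{e. e \<in> arcs G \<and> tail G e = v}"
    have "(\<Sum>e\<in>?I. ?D ?h e (L e)) = (\<Sum>e\<in>?I. r * ?D f e (L e) + q * ?D g e (L e))"
      by (intro sum.cong refl vd) (use length_pos in \<open>auto intro: less_imp_le\<close>)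
    moreover have "(\<Sum>e\<in>?O. ?D ?h e 0) = (\<Sum>e\<in>?O. r * ?D f e 0 + q * ?D g e 0)"
      by (intro sum.cong refl vd) (use length_pos in \<open>auto intro: less_imp_le\<close>)
    \<comment> \<open>The Kirchhoff condition as equality of the incoming and the outgoing sum, a
      form that is visibly linear.\<close>
    moreover have "(\<Sum>e\<in>?I. ?D u e (L e)) = (\<Sum>e\<in>?O. ?D u e 0)" if "u \<in> eigenspace \<kappa>" for u
      using that v by (auto simp: eigenspace_def neg_laplacian_def laplacian_domain_def Kirchhoff_at_def)
    ultimately show ?thesis
      using f g by (simp add: Kirchhoff_at_def sum.distrib flip: sum_distrib_left)
  qed
  moreover have "continuous_map Gamma.mtopology euclideanreal ?h"
    using f g unfolding eigenspace_def neg_laplacian_def laplacian_domain_def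
    by (intro continuous_map_add continuous_map_real_mult_left) auto
  ultimately have "?h \<in> laplacian_domain"
    using f g weak unfolding laplacian_domain_def Sobolev_H2_def
    by (auto simp: eigenspace_def neg_laplacian_def laplacian_domain_def)
  with weak show ?thesis by (simp add: eigenspace_def neg_laplacian_def)
qed

section \<open>Local maxima in the interior of an edge\<close>

text \<open>For \<kappa> = \<open>mu 2\<close> these are the parameters of the inner points of e in
  \<open>M_loc\<close>. The nonzero value at s makes any such element of the eigenspace an
  eigenfunction.\<close>

definition edge_critical :: "real \<Rightarrow> 'e \<Rightarrow> real set" where
  "edge_critical \<kappa> e = {s \<in> {0<..<L e}. \<exists>\<psi>\<in>eigenspace \<kappa>.
     on_edge \<psi> e s \<noteq> 0 \<and> (on_edge \<psi> e has_real_derivative 0) (at s)}"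

lemma on_edge_at_critical_point:
  assumes \<psi>: "\<psi> \<in> eigenspace \<kappa>" and e: "e \<in> arcs G" and s: "s \<in> {0<..<L e}"
    and crit: "(on_edge \<psi> e has_real_derivative 0) (at s)" and t: "t \<in> {0..L e}"
  shows "on_edge \<psi> e t = on_edge \<psi> e s * gen_cos \<kappa> (t - s)"
proof -
  obtain F F' where F: "\<And>x. (F has_real_derivative F' x) (at x)"
    and F': "\<And>x. (F' has_real_derivative - \<kappa> * F x) (at x)"
    and eq: "\<And>x. x \<in> {0..L e} \<Longrightarrow> on_edge \<psi> e x = F x"
    using eigenspace_on_edge[OF \<psi> e] by metis
  have "(F has_real_derivative 0) (at s)"
    by (rule has_field_derivative_transform_within_open[OF crit _ s]) (auto simp: eq)
  then have "F' s = 0" using F DERIV_unique by blast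
  then have "F t = F s * gen_cos \<kappa> (t - s)"
    using harmonic_oscillator_unique[of UNIV s t F F' \<kappa>] F F' by simp
  then show ?thesis using s t by (simp add: eq)
qed

lemma edge_critical_dichotomy:
  assumes e: "e \<in> arcs G"
  shows "finite (edge_critical \<kappa> e) \<or> edge_critical \<kappa> e = {0<..<L e}"
proof (rule disjCI)
  assume "edge_critical \<kappa> e \<noteq> {0<..<L e}"
  show "finite (edge_critical \<kappa> e)"
  proof (rule ccontr)
    assume inf: "infinite (edge_critical \<kappa> e)"
    obtain \<delta> where \<delta>: "\<delta> > 0" "\<And>x. x \<noteq> 0 \<Longrightarrow> \<bar>x\<bar> < \<delta> \<Longrightarrow> gen_sin \<kappa> x \<noteq> 0"
      using gen_sin_isolated_zero by blast
    have "edge_critical \<kappa> e \<subseteq> {0..L e}" by (auto simp: edge_critical_def)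
    \<comment> \<open>Around an accumulation point two critical parameters lie within distance
      \<delta> of each other.\<close>
    then obtain x where "x islimpt edge_critical \<kappa> e"
      using Heine_Borel_imp_Bolzano_Weierstrass[OF compact_Icc inf] by blast
    then have inf': "infinite (edge_critical \<kappa> e \<inter> ball x (\<delta> / 2))"
      using \<delta>(1) by (simp add: islimpt_eq_infinite_ball)
    then obtain p where p: "p \<in> edge_critical \<kappa> e" "p \<in> ball x (\<delta> / 2)"
      using infinite_imp_nonempty by blast
    obtain q where q: "q \<in> edge_critical \<kappa> e" "q \<in> ball x (\<delta> / 2)" and "p \<noteq> q"
      using infinite_imp_nonempty[OF infinite_remove[OF inf', of p]] by blast
    have pq: "gen_sin \<kappa> (p - q) \<noteq> 0"
      using p(2) q(2) \<open>p \<noteq> q\<close> unfolding mem_ball dist_real_def by (intro \<delta>(2)) linarith+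
    obtain \<psi> where \<psi>: "\<psi> \<in> eigenspace \<kappa>" "on_edge \<psi> e p \<noteq> 0"
        "(on_edge \<psi> e has_real_derivative 0) (at p)"
      using p by (auto simp: edge_critical_def)
    obtain \<theta> where \<theta>: "\<theta> \<in> eigenspace \<kappa>" "on_edge \<theta> e q \<noteq> 0"
        "(on_edge \<theta> e has_real_derivative 0) (at q)"
      using q by (auto simp: edge_critical_def)
    have "t \<in> edge_critical \<kappa> e" if t: "t \<in> {0<..<L e}" for t
    proof -
      \<comment> \<open>Dividing by the values at p and q normalises the restrictions to C(x - p)
        and C(x - q). The coefficients are chosen so that the derivative at t cancels, while the
        value there is S(p - q) by \<open>gen_sin_diff\<close>.\<close>
      define h where "h x = (gen_sin \<kappa> (t - q) / on_edge \<psi> e p) * \<psi> x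
        + (- gen_sin \<kappa> (t - p) / on_edge \<theta> e q) * \<theta> x" for x
      define H where "H x = gen_sin \<kappa> (t - q) * gen_cos \<kappa> (x - p)
        - gen_sin \<kappa> (t - p) * gen_cos \<kappa> (x - q)" for x
      have h: "h \<in> eigenspace \<kappa>"
        unfolding h_def[abs_def] using \<psi>(1) \<theta>(1) by (rule eigenspace_lincomb)
      have eq: "H x = on_edge h e x" if "x \<in> {0<..<L e}" for x
      proof -
        have "on_edge \<psi> e x = on_edge \<psi> e p * gen_cos \<kappa> (x - p)"
          "on_edge \<theta> e x = on_edge \<theta> e q * gen_cos \<kappa> (x - q)"
          using that p q \<psi> \<theta> e by (auto intro!: on_edge_at_critical_point simp: edge_critical_def)
        then show ?thesis
          using \<psi>(2) \<theta>(2) by (simp add: h_def H_def on_edge_def)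
      qed
      have "(H has_real_derivative 0) (at t)"
        unfolding H_def by (auto intro!: derivative_eq_intros)
      then have "(on_edge h e has_real_derivative 0) (at t)"
        by (rule has_field_derivative_transform_within_open[OF _ _ t]) (auto simp: eq)
      moreover have "on_edge h e t = gen_sin \<kappa> (p - q)"
        using eq[OF t] gen_sin_diff[of \<kappa> t q p] by (simp add: H_def)
      ultimately show ?thesis
        using h t pq by (auto simp: edge_critical_def intro!: bexI[of _ h])
    qed
    then have "edge_critical \<kappa> e = {0<..<L e}" by (auto simp: edge_critical_def)
    with \<open>edge_critical \<kappa> e \<noteq> {0<..<L e}\<close> show False by contradiction
  qed
qed

section \<open>Critical points and local maxima\<close>

text \<open>A tent function of height r centred at s is 1-Lipschitz along every edge and vanishes at
  all vertices and on all other edges. A point closer than r must therefore lie where the tent is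
  positive.\<close>

lemma mball_Inner:
  assumes x: "Inner e s \<in> points" and y: "y \<in> Gamma.mball (Inner e s) (min s (L e - s))"
  shows "\<exists>t. y = Inner e t"
proof -
  have e: "e \<in> arcs G" "0 < s" "s < L e" using x by (auto simp: points_def)
  define r where "r = min s (L e - s)"
  define h where "h z = (case z of Vertex v \<Rightarrow> 0
      | Inner e' t \<Rightarrow> if e' = e then max 0 (r - \<bar>t - s\<bar>) else 0)" for z :: "('v, 'e) point"
  have r: "0 < r" using e by (simp add: r_def)
  have ep: "h (edge_point e' t) = (if e' = e then max 0 (r - \<bar>t - s\<bar>) else 0)"
    if "t \<in> {0..L e'}" for e' t
    using that by (auto simp: h_def edge_point_def r_def)
  have "\<bar>h (edge_point e' t) - h (edge_point e' t')\<bar> \<le> 1 * \<bar>t' - t\<bar>"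
    if "e' \<in> arcs G" "t \<in> {0..L e'}" "t' \<in> {0..L e'}" for e' t t'
    using that by (auto simp: ep)
  then have "\<bar>h (Inner e s) - h y\<bar> \<le> 1 * path_dist (Inner e s) y"
    by (rule Lipschitz_path_dist) (use x y in auto)
  also have "\<dots> < r" using y by (simp add: r_def)
  finally have "h y \<noteq> 0" using r by (auto simp: h_def)
  then show ?thesis by (auto simp: h_def split: point.splits if_splits)
qed

text \<open>A local maximum is critical by Fermat's theorem. Conversely a critical eigenfunction is
  a multiple of C(t - s) along the edge, and the right sign gives a maximum.\<close>

lemma Inner_in_M_loc_iff:
  "Inner e s \<in> M_loc \<longleftrightarrow> e \<in> arcs G \<and> s \<in> edge_critical (mu 2) e"
proof (cases "Inner e s \<in> points")
  case False
  then show ?thesis by (auto simp: M_loc_def edge_critical_def points_def)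
next
  case x: True
  then have e: "e \<in> arcs G" and s: "s \<in> {0<..<L e}" by (auto simp: points_def)
  have ep: "edge_point e t = Inner e t" if "t \<in> {0<..<L e}" for t
    using that by (auto simp: edge_point_def)
  have "s \<in> edge_critical (mu 2) e" if loc: "Inner e s \<in> M_loc"
  proof -
    obtain \<psi> \<epsilon> where \<psi>: "eigenfunction (mu 2) \<psi>" and "0 < \<epsilon>" and nz: "\<psi> (Inner e s) \<noteq> 0"
      and max: "\<forall>y\<in>Gamma.mball (Inner e s) \<epsilon>. \<psi> y \<le> \<psi> (Inner e s)"
      using loc by (auto simp: M_loc_def)
    have E: "\<psi> \<in> eigenspace (mu 2)" using \<psi> by (simp add: eigenfunction_def)
    obtain F F' where F: "\<And>x. (F has_real_derivative F' x) (at x)"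
      and eq: "\<And>x. x \<in> {0..L e} \<Longrightarrow> on_edge \<psi> e x = F x"
      using eigenspace_on_edge[OF E e] by metis
    have D: "(on_edge \<psi> e has_real_derivative F' s) (at s)"
      by (rule has_field_derivative_transform_within_open[OF F _ s]) (auto simp: eq)
    \<comment> \<open>Keeps the parameters inside the open edge and their points inside the ball on
      which \<psi> is maximal at the centre.\<close>
    define d where "d = min \<epsilon> (min s (L e - s))"
    have "0 < d" using s \<open>0 < \<epsilon>\<close> by (simp add: d_def)
    have "on_edge \<psi> e t \<le> on_edge \<psi> e s" if "\<bar>s - t\<bar> < d" for t
    proof -
      have t: "t \<in> {0<..<L e}" using that s by (auto simp: d_def)
      then have "path_dist (Inner e s) (Inner e t) \<le> \<bar>t - s\<bar>"
        using path_dist_edge_point_le[OF e, of s t] s by (simp add: ep)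
      moreover have "Inner e t \<in> points" using e t by (auto simp: points_def)
      ultimately have "Inner e t \<in> Gamma.mball (Inner e s) \<epsilon>"
        using x that by (auto simp: d_def)
      then show ?thesis using max s t by (simp add: on_edge_def ep)
    qed
    then have "F' s = 0" using DERIV_local_max[OF D \<open>0 < d\<close>] by blast
    then show ?thesis
      using D E nz s by (auto simp: edge_critical_def on_edge_def ep)
  qed
  moreover have "Inner e s \<in> M_loc" if crit: "s \<in> edge_critical (mu 2) e"
  proof -
    obtain \<psi> where E: "\<psi> \<in> eigenspace (mu 2)" and nz: "on_edge \<psi> e s \<noteq> 0"
      and D: "(on_edge \<psi> e has_real_derivative 0) (at s)"
      using crit by (auto simp: edge_critical_def)
    \<comment> \<open>Makes the value at s positive when C \<le> 1 and negative when C \<ge>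
      1.\<close>
    define \<sigma> :: real where
      "\<sigma> = (if mu 2 \<ge> 0 then sgn (on_edge \<psi> e s) else - sgn (on_edge \<psi> e s))"
    \<comment> \<open>The zero summand puts the scalar multiple into the shape of
      \<open>eigenspace_lincomb\<close>.\<close>
    define \<theta> where "\<theta> x = \<sigma> * \<psi> x + 0 * \<psi> x" for x
    have \<theta>E: "\<theta> \<in> eigenspace (mu 2)"
      unfolding \<theta>_def[abs_def] using E E by (rule eigenspace_lincomb)
    have \<theta>s: "on_edge \<theta> e s = (if mu 2 \<ge> 0 then \<bar>on_edge \<psi> e s\<bar> else - \<bar>on_edge \<psi> e s\<bar>)"
      by (simp add: \<theta>_def \<sigma>_def on_edge_def abs_sgn mult.commute)
    have max: "on_edge \<theta> e t \<le> on_edge \<theta> e s" if "t \<in> {0..L e}" for t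
    proof -
      have "on_edge \<theta> e t = on_edge \<theta> e s * gen_cos (mu 2) (t - s)"
        using on_edge_at_critical_point[OF E e s D that] by (simp add: \<theta>_def on_edge_def)
      moreover have "\<bar>v\<bar> * c \<le> \<bar>v\<bar>" if "c \<le> 1" for v c :: real
        using that by (simp add: mult_left_le)
      moreover have "\<bar>v\<bar> \<le> \<bar>v\<bar> * c" if "1 \<le> c" for v c :: real
        using that mult_left_mono[of 1 c "\<bar>v\<bar>"] by simp
      ultimately show ?thesis
        using gen_cos_extremum[of "mu 2" "t - s"] by (auto simp: \<theta>s)
    qed
    have "\<forall>y\<in>Gamma.mball (Inner e s) (min s (L e - s)). \<theta> y \<le> \<theta> (Inner e s)"
    proof
      fix y assume y: "y \<in> Gamma.mball (Inner e s) (min s (L e - s))"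
      then obtain t where t: "y = Inner e t" using mball_Inner[OF x] by blast
      with y have "Inner e t \<in> points" by simp
      then have "t \<in> {0<..<L e}" by (simp add: points_def image_iff)
      with max[of t] s t show "\<theta> y \<le> \<theta> (Inner e s)" by (simp add: on_edge_def ep)
    qed
    moreover have "on_edge \<theta> e s \<noteq> 0" using nz by (simp add: \<theta>s)
    moreover have "eigenfunction (mu 2) \<theta>"
      using \<theta>E e s calculation(2) by (auto simp: eigenfunction_def intro!: bexI[of _ e] bexI[of _ s])
    ultimately show ?thesis
      using x s by (auto simp: M_loc_def on_edge_def ep intro!: exI[of _ \<theta>] exI[of _ "min s (L e - s)"])
  qed
  ultimately show ?thesis using e by blast
qed

lemma connectedin_open_edge:
  assumes "e \<in> arcs G"
  shows "connectedin Gamma.mtopology (Inner e ` {0<..<L e})"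
proof -
  have "connectedin (top_of_set {0..L e}) {0<..<L e}"
    by (auto simp: connectedin_subtopology)
  then have "connectedin Gamma.mtopology (edge_point e ` {0<..<L e})"
    by (rule connectedin_continuous_map_image[OF continuous_map_edge_point[OF assms]])
  also have "edge_point e ` {0<..<L e} = Inner e ` {0<..<L e}"
    by (intro image_cong) (auto simp: edge_point_def)
  finally show ?thesis .
qed

end

section \<open>Counting components\<close>

text \<open>Each component contains a nonempty piece from P, because a connected piece that meets it
  lies inside it. Distinct components are disjoint, so choosing such a piece is injective.\<close>

lemma finite_connected_components_of:
  assumes "finite P" "\<Union>P = topspace X" "\<And>S. S \<in> P \<Longrightarrow> connectedin X S"
  shows "finite (connected_components_of X)"
proof -
  have "\<exists>S\<in>P. S \<noteq> {} \<and> S \<subseteq> C" if C: "C \<in> connected_components_of X" for C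
  proof -
    obtain x where x: "x \<in> C" "x \<in> topspace X"
      using C nonempty_connected_components_of connected_components_of_subset by fastforce
    then obtain S where "S \<in> P" "x \<in> S" using assms(2) by blast
    with x assms(3) C show ?thesis
      using connected_components_of_maximal[of C X S] by (auto simp: disjnt_iff)
  qed
  then obtain pick where pick: "\<And>C. C \<in> connected_components_of X \<Longrightarrow>
      pick C \<in> P \<and> pick C \<noteq> {} \<and> pick C \<subseteq> C"
    by metis
  have "inj_on pick (connected_components_of X)"
  proof (rule inj_onI)
    fix C D assume *: "C \<in> connected_components_of X" "D \<in> connected_components_of X" "pick C = pick D"
    then have "\<not> disjnt C D" using pick[of C] pick[of D] by (auto simp: disjnt_iff)
    with * show "C = D"
      using pairwise_disjoint_connected_components_of[of X] by (auto simp: pairwise_def)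
  qed
  then show ?thesis
    using inj_on_finite[of pick _ P] pick assms(1) by blast
qed

theorem proposition4p4:
  fixes G :: "('v, 'e) pre_digraph" and L :: "'e \<Rightarrow> real"
  assumes "metric_graph G L"
  shows "finite (connected_components_of
           (subtopology (Metric_space.mtopology (metric_graph.points G L) (metric_graph.path_dist G L))
             (metric_graph.M_loc G L)))
       \<and> (finite (metric_graph.M_loc G L) \<or> uncountable (metric_graph.M_loc G L))"
proof -
  interpret metric_graph G L by fact
  let ?Z = "edge_critical (mu 2)"
  define A where "A = {e \<in> arcs G. finite (?Z e)}"
  \<comment> \<open>The vertices in \<open>M_loc\<close> enter this exceptional set wholesale:
    finiteness of the vertex set is all that is used about them.\<close>
  define N where "N = M_loc \<inter> Vertex ` verts G \<union> (\<Union>e\<in>A. Inner e ` ?Z e)"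
  \<comment> \<open>Connected pieces covering \<open>M_loc\<close>. They may be smaller than the
    components, since open edges can be joined through a vertex in \<open>M_loc\<close>.\<close>
  define P where "P = (\<lambda>x. {x}) ` N \<union> (\<lambda>e. Inner e ` {0<..<L e}) ` (arcs G - A)"
  have full: "?Z e = {0<..<L e}" if "e \<in> arcs G - A" for e
    using that edge_critical_dichotomy[of e "mu 2"] by (auto simp: A_def)
  have finN: "finite N" by (auto simp: N_def A_def)
  have M: "M_loc = N \<union> (\<Union>e\<in>arcs G - A. Inner e ` {0<..<L e})"
  proof (intro set_eqI)
    fix x
    show "x \<in> M_loc \<longleftrightarrow> x \<in> N \<union> (\<Union>e\<in>arcs G - A. Inner e ` {0<..<L e})"
    proof (cases x)
      case (Vertex v)
      then show ?thesis by (auto simp: N_def M_loc_def points_def)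
    next
      case (Inner e s)
      have "x \<in> N \<longleftrightarrow> e \<in> A \<and> s \<in> ?Z e"
        by (auto simp: N_def Inner)
      moreover have "x \<in> (\<Union>e\<in>arcs G - A. Inner e ` {0<..<L e}) \<longleftrightarrow>
          e \<in> arcs G - A \<and> s \<in> {0<..<L e}"
        unfolding Inner by blast
      moreover have "A \<subseteq> arcs G" by (auto simp: A_def)
      ultimately show ?thesis
        using full[of e] Inner_in_M_loc_iff[of e s] unfolding Inner by blast
    qed
  qed
  have sub: "M_loc \<subseteq> points" by (auto simp: M_loc_def)
  have "finite (connected_components_of (subtopology Gamma.mtopology M_loc))"
  proof (rule finite_connected_components_of)
    show "finite P" using finN by (simp add: P_def)
    show "\<Union>P = topspace (subtopology Gamma.mtopology M_loc)"
      using sub by (auto simp: P_def M)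
    show "connectedin (subtopology Gamma.mtopology M_loc) S" if "S \<in> P" for S
    proof -
      have "S \<subseteq> M_loc" using that by (auto simp: P_def M)
      moreover have "connectedin Gamma.mtopology S"
        using that sub connectedin_open_edge by (auto simp: P_def M)
      ultimately show ?thesis by (simp add: connectedin_subtopology)
    qed
  qed
  moreover have "finite M_loc" if "arcs G = A"
    using finN that by (simp add: M)
  \<comment> \<open>A single edge with infinitely many critical parameters already contributes a
    whole open interval.\<close>
  moreover have "uncountable M_loc" if e: "e \<in> arcs G - A" for e
  proof
    assume "countable M_loc"
    moreover have "Inner e ` {0<..<L e} \<subseteq> M_loc" unfolding M using e by blast
    ultimately have "countable (Inner e ` {0<..<L e} :: ('v, 'e) point set)"
      by (rule countable_subset[rotated])
    then have "countable {0<..<L e}"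
      by (rule countable_image_inj_on) (simp add: inj_on_def)
    with e length_pos[of e] show False using uncountable_open_interval[of 0 "L e"] by simp
  qed
  moreover have "arcs G = A \<or> (\<exists>e. e \<in> arcs G - A)" by (auto simp: A_def)
  ultimately show ?thesis by metis
qed

end
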